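(* For every positive integer $n$, $$\lambda(1,15;4n+1)=\lambda(3,5;2n+1)=\frac12\sum_{x,y\in\mathbb{Z},\ x^2+15y^2=2n+1}(x^2-15y^2).$$
   Context: For positive integers $a,b,n$, $\lambda(a,b;n)$ is the integer defined by the power series expansion $q\prod_{k=1}^{\infty}(1-q^{ak})^3(1-q^{bk})^3=\sum_{n=1}^{\infty}\lambda(a,b;n)q^n$ for $|q|<1$. *)

theory Defs
  imports "HOL-Complex_Analysis.Complex_Analysis"
begin

definition eta_prod :: "nat \<Rightarrow> nat \<Rightarrow> complex \<Rightarrow> complex" where
  "eta_prod a b q =
     q * (\<Prod>k. (1 - q ^ (a * Suc k)) ^ 3 * (1 - q ^ (b * Suc k)) ^ 3)"

(* The expansion starts at n = 1 in the source. Summing from n = 0 only forces the coefficient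
   of index 0 to be 0. For positive a and b the description is proper, see the theorem
   lambda_coeff_unique and the lemma sums_lambda_coeff below. *)
definition lambda_coeff :: "nat \<Rightarrow> nat \<Rightarrow> nat \<Rightarrow> int" where
  "lambda_coeff a b =
     (THE c. \<forall>q::complex. norm q < 1 \<longrightarrow> (\<lambda>n. of_int (c n) * q ^ n) sums eta_prod a b q)"

definition int_taylor :: "(complex \<Rightarrow> complex) \<Rightarrow> bool" where
  "int_taylor f \<longleftrightarrow>
     f holomorphic_on ball 0 1 \<and> (\<forall>n. (deriv ^^ n) f 0 / fact n \<in> \<int>)"

lemma int_taylor_const: "c \<in> \<int> \<Longrightarrow> int_taylor (\<lambda>_. c)"
  unfolding int_taylor_def by auto

lemma int_taylor_id: "int_taylor (\<lambda>q. q)"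
  unfolding int_taylor_def by (auto simp: higher_deriv_ident)

lemma int_taylor_diff:
  assumes "int_taylor f" "int_taylor g"
  shows "int_taylor (\<lambda>q. f q - g q)"
proof -
  have "(deriv ^^ n) (\<lambda>q. f q - g q) 0 = (deriv ^^ n) f 0 - (deriv ^^ n) g 0" for n
    by (rule higher_deriv_diff[where S = "ball 0 1"]) (use assms in \<open>auto simp: int_taylor_def\<close>)
  then show ?thesis
    using assms by (auto simp: int_taylor_def diff_divide_distrib intro!: holomorphic_intros)
qed

lemma int_taylor_mult:
  assumes "int_taylor f" "int_taylor g"
  shows "int_taylor (\<lambda>q. f q * g q)"
proof -
  have "(deriv ^^ n) (\<lambda>q. f q * g q) 0 / fact n \<in> \<int>" for n
  proof -
    have "(deriv ^^ n) (\<lambda>q. f q * g q) 0 =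
            (\<Sum>i = 0..n. of_nat (n choose i) * (deriv ^^ i) f 0 * (deriv ^^ (n - i)) g 0)"
      by (rule higher_deriv_mult[where S = "ball 0 1"]) (use assms in \<open>auto simp: int_taylor_def\<close>)
    then have "(deriv ^^ n) (\<lambda>q. f q * g q) 0 / fact n =
            (\<Sum>i = 0..n. of_nat (n choose i) * (deriv ^^ i) f 0 * (deriv ^^ (n - i)) g 0) / fact n"
      by simp
    also have "\<dots> =
            (\<Sum>i = 0..n. ((deriv ^^ i) f 0 / fact i) * ((deriv ^^ (n - i)) g 0 / fact (n - i)))"
      unfolding sum_divide_distrib
    proof (intro sum.cong refl)
      fix i assume "i \<in> {0..n}"
      then have "of_nat (n choose i) = (fact n / (fact i * fact (n - i)) :: complex)"
        by (intro binomial_fact) simp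
      then show "of_nat (n choose i) * (deriv ^^ i) f 0 * (deriv ^^ (n - i)) g 0 / fact n =
          (deriv ^^ i) f 0 / fact i * ((deriv ^^ (n - i)) g 0 / fact (n - i))"
        by simp
    qed
    also have "\<dots> \<in> \<int>"
    proof (rule Ints_sum)
      fix i
      have "(deriv ^^ i) f 0 / fact i \<in> \<int>" "(deriv ^^ (n - i)) g 0 / fact (n - i) \<in> \<int>"
        using assms unfolding int_taylor_def by blast+
      then show "(deriv ^^ i) f 0 / fact i * ((deriv ^^ (n - i)) g 0 / fact (n - i)) \<in> \<int>"
        by (rule Ints_mult)
    qed
    finally show ?thesis .
  qed
  then show ?thesis
    using assms by (auto simp: int_taylor_def intro!: holomorphic_intros)
qed

lemma int_taylor_power: "int_taylor f \<Longrightarrow> int_taylor (\<lambda>q. f q ^ n)"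
  by (induction n) (auto intro: int_taylor_const int_taylor_mult)

lemma int_taylor_prod: "(\<And>k. int_taylor (f k)) \<Longrightarrow> int_taylor (\<lambda>q. \<Prod>k<(N::nat). f k q)"
  by (induction N) (auto intro: int_taylor_const int_taylor_mult)

lemma int_taylor_limit:
  fixes f :: "nat \<Rightarrow> complex \<Rightarrow> complex"
  assumes f: "\<And>N. int_taylor (f N)"
    and lim: "\<And>r. 0 < r \<Longrightarrow> r < 1 \<Longrightarrow> uniform_limit (cball 0 r) f g sequentially"
  shows "int_taylor g"
proof -
  have hol: "f N holomorphic_on ball 0 1" for N
    using f by (auto simp: int_taylor_def)
  have "g holomorphic_on ball 0 r" if "0 < r" "r < 1" for r
  proof (rule holomorphic_uniform_limit[of 0 r f sequentially g])
    have "f N holomorphic_on cball 0 r" "f N holomorphic_on ball 0 r" for N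
      by (rule holomorphic_on_subset[OF hol]; use that in auto)+
    then show "\<forall>\<^sub>F n in sequentially. continuous_on (cball 0 r) (f n) \<and> f n holomorphic_on ball 0 r"
      by (auto intro!: always_eventually holomorphic_on_imp_continuous_on)
  qed (use lim that in auto)
  moreover have "\<exists>r. 0 < r \<and> r < 1 \<and> z \<in> ball 0 r" if "z \<in> ball 0 1" for z :: complex
    using that dense[of "norm z" 1] by (auto intro: le_less_trans[OF norm_ge_zero])
  ultimately have "g field_differentiable at z" if "z \<in> ball 0 1" for z
    using that by (meson holomorphic_on_imp_differentiable_at open_ball)
  then have "g holomorphic_on ball 0 1"
    by (auto simp: holomorphic_on_def intro: field_differentiable_at_within)
  moreover have "(deriv ^^ n) g 0 / fact n \<in> \<int>" for n
  proof -
    have "(\<lambda>N. (deriv ^^ n) (f N) 0) \<longlonglongrightarrow> (deriv ^^ n) g 0"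
    proof (rule higher_deriv_complex_uniform_limit[where A = "ball 0 (1/2)"])
      show "uniform_limit (ball 0 (1/2)) f g sequentially"
        by (rule uniform_limit_on_subset[OF lim[of "1/2"]]) auto
      show "\<forall>\<^sub>F N in sequentially. f N holomorphic_on ball 0 (1/2)"
        by (intro always_eventually allI holomorphic_on_subset[OF hol]) auto
    qed auto
    then have "(\<lambda>N. (deriv ^^ n) (f N) 0 / fact n) \<longlonglongrightarrow> (deriv ^^ n) g 0 / fact n"
      by (intro tendsto_intros) auto
    moreover have "(deriv ^^ n) (f N) 0 / fact n \<in> \<int>" for N
      using f by (auto simp: int_taylor_def)
    ultimately show ?thesis
      by (rule closed_sequentially[OF closed_Ints, rotated])
  qed
  ultimately show ?thesis
    by (simp add: int_taylor_def)
qed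

lemma convergent_prod_euler:
  fixes q :: complex
  assumes "0 < c" "norm q < 1"
  shows "convergent_prod (\<lambda>k. 1 - q ^ (c * Suc k))"
proof -
  have "summable (\<lambda>k. norm (q ^ Suc k))"
    using assms summable_geometric[of "norm q"]
    unfolding norm_power by (subst summable_Suc_iff[where f = "\<lambda>k. norm q ^ k"]) simp
  moreover have "norm (norm (q ^ (c * Suc k))) \<le> norm (q ^ Suc k)" for k
    using power_decreasing[of "Suc k" "c * Suc k" "norm q"] mult_le_mono1[of 1 c "Suc k"] assms
    by (simp add: norm_power del: power_Suc mult_Suc_right)
  ultimately have "summable (\<lambda>k. norm (q ^ (c * Suc k)))"
    by (rule summable_comparison_test'[where N = 0])
  then have "abs_convergent_prod (\<lambda>k. 1 - q ^ (c * Suc k))"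
    by (subst abs_convergent_prod_conv_summable) (simp add: norm_minus_commute)
  then show ?thesis
    by (rule abs_convergent_prod_imp_convergent_prod)
qed

lemma uniform_limit_euler:
  fixes r :: real
  assumes "0 < c" "0 < r" "r < 1"
  shows "uniform_limit (cball 0 r) (\<lambda>N q::complex. \<Prod>k<N. 1 - q ^ (c * Suc k))
           (\<lambda>q. \<Prod>k. 1 - q ^ (c * Suc k)) sequentially"
proof -
  let ?f = "\<lambda>k q::complex. 1 - q ^ (c * Suc k)"
  have "uniformly_convergent_on (cball 0 r) (\<lambda>N q. \<Prod>k<N. ?f k q)"
  proof (rule uniformly_convergent_on_prod')
    show "uniformly_convergent_on (cball 0 r) (\<lambda>N q. \<Sum>n<N. norm (?f n q - 1))"
    proof (rule Weierstrass_m_test'[where M = "\<lambda>n. r ^ Suc n"])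
      fix n :: nat and q :: complex
      assume "q \<in> cball 0 r"
      then have "norm q ^ (c * Suc n) \<le> r ^ (c * Suc n)"
        by (intro power_mono) auto
      also have "\<dots> \<le> r ^ Suc n"
        using power_decreasing[of "Suc n" "c * Suc n" r] mult_le_mono1[of 1 c "Suc n"] assms
        by (simp del: power_Suc mult_Suc_right)
      finally show "norm (norm (?f n q - 1)) \<le> r ^ Suc n"
        by (simp add: norm_power)
    next
      show "summable (\<lambda>n. r ^ Suc n)"
        using assms summable_geometric[of r]
        by (subst summable_Suc_iff[where f = "\<lambda>k. r ^ k"]) simp
    qed
  qed (auto intro!: continuous_intros)
  then obtain g where g: "uniform_limit (cball 0 r) (\<lambda>N q. \<Prod>k<N. ?f k q) g sequentially"
    by (auto simp: uniformly_convergent_on_def)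
  have "g q = (\<Prod>k. ?f k q)" if q: "q \<in> cball 0 r" for q
  proof -
    have "(\<lambda>N. \<Prod>k<N. ?f k q) \<longlonglongrightarrow> g q"
      by (rule tendsto_uniform_limitI[OF g q])
    moreover have "(\<lambda>N. \<Prod>k<N. ?f k q) \<longlonglongrightarrow> (\<Prod>k. ?f k q)"
      using convergent_prod_LIMSEQ[OF convergent_prod_euler[of c q]] assms q
      by (subst LIMSEQ_lessThan_iff_atMost) auto
    ultimately show ?thesis
      by (rule LIMSEQ_unique)
  qed
  then show ?thesis
    using g uniform_limit_cong'[of "cball 0 r"] by (metis (no_types, lifting))
qed

lemma int_taylor_euler:
  assumes "0 < c"
  shows "int_taylor (\<lambda>q. \<Prod>k. 1 - q ^ (c * Suc k))"
  by (rule int_taylor_limit[OF _ uniform_limit_euler[OF assms]])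
     (auto intro!: int_taylor_prod int_taylor_diff int_taylor_const int_taylor_power int_taylor_id
       simp del: mult_Suc_right power_Suc)

lemma eta_prod_eq:
  assumes "0 < a" "0 < b" "norm q < 1"
  shows "eta_prod a b q =
           q * ((\<Prod>k. 1 - q ^ (a * Suc k)) ^ 3 * (\<Prod>k. 1 - q ^ (b * Suc k)) ^ 3)"
  unfolding eta_prod_def
  using convergent_prod_euler[OF assms(1,3)] convergent_prod_euler[OF assms(2,3)]
  by (simp add: prodinf_mult[symmetric] prodinf_power[symmetric] convergent_prod_power
      del: mult_Suc_right power_Suc)

lemma lambda_coeff_exists:
  assumes "0 < a" "0 < b"
  shows "\<exists>c :: nat \<Rightarrow> int.
           \<forall>q::complex. norm q < 1 \<longrightarrow> (\<lambda>n. of_int (c n) * q ^ n) sums eta_prod a b q"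
proof -
  let ?F = "\<lambda>q::complex. q * ((\<Prod>k. 1 - q ^ (a * Suc k)) ^ 3 * (\<Prod>k. 1 - q ^ (b * Suc k)) ^ 3)"
  have F: "int_taylor ?F"
    using assms
    by (intro int_taylor_mult int_taylor_power int_taylor_euler int_taylor_id)
  then have "\<forall>n. \<exists>m::int. (deriv ^^ n) ?F 0 / fact n = of_int m"
    by (auto simp: int_taylor_def elim!: Ints_cases)
  then obtain c :: "nat \<Rightarrow> int" where c: "\<And>n. (deriv ^^ n) ?F 0 / fact n = of_int (c n)"
    by metis
  have "(\<lambda>n. of_int (c n) * q ^ n) sums eta_prod a b q" if q: "norm q < 1" for q :: complex
  proof -
    have "(\<lambda>n. (deriv ^^ n) ?F 0 / fact n * (q - 0) ^ n) sums ?F q"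
      by (rule holomorphic_power_series[where r = 1]) (use F q in \<open>auto simp: int_taylor_def\<close>)
    then show ?thesis
      unfolding c eta_prod_eq[OF assms q] by simp
  qed
  then show ?thesis by blast
qed

lemma power_series_coeff_unique:
  fixes c d :: "nat \<Rightarrow> int" and F :: "complex \<Rightarrow> complex"
  assumes c: "\<And>q. norm q < 1 \<Longrightarrow> (\<lambda>n. of_int (c n) * q ^ n) sums F q"
    and d: "\<And>q. norm q < 1 \<Longrightarrow> (\<lambda>n. of_int (d n) * q ^ n) sums F q"
  shows "c = d"
proof -
  define C D :: "complex fps"
    where "C = Abs_fps (\<lambda>n. of_int (c n))" and "D = Abs_fps (\<lambda>n. of_int (d n))"
  have radius: "fps_conv_radius (Abs_fps (\<lambda>n. of_int (h n) :: complex)) > 0"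
    if h: "\<And>q. norm q < 1 \<Longrightarrow> (\<lambda>n. of_int (h n) * q ^ n) sums F q" for h :: "nat \<Rightarrow> int"
  proof -
    have "summable (\<lambda>n. of_int (h n) * (1/2 :: complex) ^ n)"
      using h[of "1/2"] by (auto simp: sums_iff)
    then have "conv_radius (\<lambda>n. of_int (h n) :: complex) \<ge> norm (1/2 :: complex)"
      by (rule conv_radius_geI)
    then show ?thesis
      unfolding fps_conv_radius_def by (auto intro: less_le_trans[rotated])
  qed
  have "C = D"
  proof (rule eval_fps_eqD)
    have "eval_fps C z = eval_fps D z" if "z \<in> ball 0 1" for z
      using c[of z] d[of z] that by (auto simp: C_def D_def eval_fps_def sums_iff)
    then show "\<forall>\<^sub>F z in nhds 0. eval_fps C z = eval_fps D z"
      by (intro eventually_nhds_in_open[of "ball 0 1", THEN eventually_mono]) auto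
  qed (unfold C_def D_def, (rule radius, fact)+)
  then have "fps_nth C n = fps_nth D n" for n
    by simp
  then show ?thesis
    by (auto simp: C_def D_def)
qed

theorem lambda_coeff_unique:
  assumes "0 < a" "0 < b"
  shows "\<exists>!c :: nat \<Rightarrow> int.
           \<forall>q::complex. norm q < 1 \<longrightarrow> (\<lambda>n. of_int (c n) * q ^ n) sums eta_prod a b q"
proof -
  obtain c :: "nat \<Rightarrow> int" where
    "\<forall>q::complex. norm q < 1 \<longrightarrow> (\<lambda>n. of_int (c n) * q ^ n) sums eta_prod a b q"
    using lambda_coeff_exists[OF assms] by blast
  then show ?thesis
    using power_series_coeff_unique[where F = "eta_prod a b"] by blast
qed

lemma sums_lambda_coeff:
  assumes "0 < a" "0 < b" "norm (q::complex) < 1"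
  shows "(\<lambda>n. of_int (lambda_coeff a b n) * q ^ n) sums eta_prod a b q"
  using theI'[OF lambda_coeff_unique[OF assms(1,2)]] assms(3)
  unfolding lambda_coeff_def[symmetric] by blast

lemma finite_form_reps: "finite {(x, y). x\<^sup>2 + 15 * y\<^sup>2 = (m::int)}"
proof (rule finite_subset)
  have "\<bar>x\<bar> \<le> m \<and> \<bar>y\<bar> \<le> m" if "x\<^sup>2 + 15 * y\<^sup>2 = m" for x y :: int
  proof -
    have "\<bar>t\<bar> \<le> t\<^sup>2" for t :: int
      by (cases "t = 0") (use mult_left_mono[of 1 "\<bar>t\<bar>" "\<bar>t\<bar>"] in \<open>auto simp: power2_eq_square\<close>)
    from this[of x] this[of y] show ?thesis
      using that zero_le_power2[of x] zero_le_power2[of y] by linarith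
  qed
  then show "{(x, y). x\<^sup>2 + 15 * y\<^sup>2 = m} \<subseteq> {-m..m} \<times> {-m..m}"
    by (force simp: abs_le_iff)
qed simp

end

theory Submission
  imports Defs
begin

text \<open>
  Jacobi's identity \<open>\<Prod>(1 - q^k)^3 = \<Sum>(-1)^k (2k+1) q^(k(k+1)/2)\<close> makes the coefficients explicit.
  The numbers \<open>(-1)^k (2k+1)\<close> run exactly once through the integers that are 1 modulo 4, and
  \<open>8 * k(k+1)/2 + 1 = (2k+1)^2\<close>; so multiplying two such series and comparing coefficients
  (\<open>lambda_coeff_eq_sum\<close>) expresses \<open>\<lambda>(a,b;n)\<close> as the sum of \<open>x y\<close> over the solutions of
  \<open>a x^2 + b y^2 = 8 n + a + b - 8\<close> with \<open>x\<close> and \<open>y\<close> both 1 modulo 4.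

  Put \<open>N = 2 n + 1\<close>. The two coefficients in question belong to the equations
  \<open>3 x^2 + 5 y^2 = 8 N\<close> and \<open>x^2 + 15 y^2 = 16 N\<close>. Since \<open>N\<close> is odd, linear substitutions
  given by multiplication by \<open>\<surd>3 + \<surd>(-5)\<close> and by \<open>1 + \<surd>(-15)\<close>, respectively, identify both
  solution sets with the same set: the solutions of \<open>u^2 + 15 v^2 = N\<close> with \<open>u + v\<close> equal to
  1 modulo 4. The product \<open>x y\<close> becomes \<open>u^2 + 2 u v - 15 v^2\<close> and \<open>u^2 - 14 u v - 15 v^2\<close>,
  respectively (\<open>sum_over_form_3_5\<close>, \<open>sum_over_form_1_15\<close>). Exactly one of each pair of
  solutions \<open>(u,v)\<close>, \<open>(-u,-v)\<close> satisfies the congruence, so these sums are half of the sums over all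
  solutions, and there the terms in \<open>u v\<close> cancel under \<open>v \<mapsto> -v\<close>
  (\<open>sum_half_system_eq\<close>).

  Jacobi's identity itself is the limit of a finite one. In the q-binomial theorem for
  \<open>\<Prod>(q^n - w q^j)\<close> over \<open>j \<le> 2n\<close>, the factor with \<open>j = n\<close> vanishes at \<open>w = 1\<close>; the derivative at
  \<open>w = 1\<close> is then the product of the other factors on one side, and a sum of q-binomial coefficients with
  linear weights on the other (\<open>jacobi_cube_finite\<close>). Tannery's theorem gives the passage to the
  limit (\<open>jacobi_cube\<close>).
\<close>

section \<open>The q-binomial theorem\<close>

text \<open>The q-Pochhammer symbol \<open>(q; q)_n\<close>.\<close>

definition qfact :: "'a::comm_ring_1 \<Rightarrow> nat \<Rightarrow> 'a" where
  "qfact q n = (\<Prod>j<n. 1 - q ^ Suc j)"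

text \<open>
  Defining the Gaussian binomial coefficients by the Pascal recurrence instead of a quotient keeps
  them meaningful in every commutative ring, including at roots of unity.
\<close>

fun qbinom :: "'a::comm_ring_1 \<Rightarrow> nat \<Rightarrow> nat \<Rightarrow> 'a" where
  "qbinom q m 0 = 1"
| "qbinom q 0 (Suc k) = 0"
| "qbinom q (Suc m) (Suc k) = qbinom q m k + q ^ Suc k * qbinom q m (Suc k)"

lemma qfact_0 [simp]: "qfact q 0 = 1"
  and qfact_Suc: "qfact q (Suc n) = qfact q n * (1 - q ^ Suc n)"
  by (simp_all add: qfact_def)

lemma qbinom_eq_0: "m < k \<Longrightarrow> qbinom q m k = 0"
  by (induction q m k rule: qbinom.induct) auto

lemma qbinom_self [simp]: "qbinom q m m = 1"
  by (induction m) (simp_all add: qbinom_eq_0)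

lemma qfact_mult_qbinom: "qfact q k * qfact q l * qbinom q (k + l) k = qfact q (k + l)"
proof (induction "k + l" arbitrary: k l)
  case (Suc m)
  consider "k = 0" | "l = 0" | k' l' where "k = Suc k'" "l = Suc l'"
    using not0_implies_Suc by blast
  then show ?case
  proof cases
    case (3 k' l')
    have "qfact q k' * qfact q l * qbinom q (k' + l) k' = qfact q (k' + l)"
      by (rule Suc.hyps) (use Suc.hyps(2) 3 in simp)
    then have 1: "qfact q k' * qfact q l * qbinom q m k' = qfact q m"
      using Suc.hyps(2) 3 by simp
    have "qfact q k * qfact q l' * qbinom q (k + l') k = qfact q (k + l')"
      by (rule Suc.hyps) (use Suc.hyps(2) 3 in simp)
    then have 2: "qfact q k * qfact q l' * qbinom q m k = qfact q m"
      using Suc.hyps(2) 3 by simp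
    have m: "k + l = Suc m" using Suc.hyps(2) by simp
    have "qfact q k * qfact q l * qbinom q (Suc m) k =
          (1 - q ^ k) * (qfact q k' * qfact q l * qbinom q m k') +
          q ^ k * (1 - q ^ l) * (qfact q k * qfact q l' * qbinom q m k)"
      by (simp only: 3 qbinom.simps qfact_Suc) (simp only: algebra_simps)
    also have "\<dots> = qfact q m * (1 - q ^ (k + l))"
      unfolding 1 2 by (simp add: algebra_simps power_add)
    also have "\<dots> = qfact q (k + l)"
      by (simp only: m qfact_Suc)
    finally show ?thesis by (simp only: m)
  qed simp_all
qed simp

lemma zero_choose_2 [simp]: "0 choose 2 = 0"
  and Suc_choose_2: "Suc k choose 2 = (k choose 2) + k"
  by (simp_all add: numeral_2_eq_2)

lemma square_eq_choose_2: "k * k = k + 2 * (k choose 2)"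
  by (induction k) (simp_all add: Suc_choose_2)

text \<open>
  Induction on the number of factors: splitting off the factor with \<open>j = 0\<close> replaces \<open>x\<close> by
  \<open>x q\<close> in the remaining ones, which supplies the power of \<open>q\<close> in the Pascal recurrence. The form that
  is homogeneous in \<open>x\<close> and \<open>y\<close> allows \<open>y\<close> to be a power of \<open>q\<close> later, where the usual form
  would need negative powers.
\<close>

theorem qbinomial_theorem:
  fixes x y q :: "'a::comm_ring_1"
  shows "(\<Prod>j<m. y + x * q ^ j) =
           (\<Sum>k\<le>m. qbinom q m k * q ^ (k choose 2) * x ^ k * y ^ (m - k))"
proof (induction m arbitrary: x)
  case (Suc m)
  define t where "t k = qbinom q m k * q ^ (k choose 2) * q ^ k * x ^ k * y ^ (m - k)" for k
  have "(\<Prod>j<Suc m. y + x * q ^ j) = (y + x) * (\<Prod>j<m. y + (x * q) * q ^ j)"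
    by (subst prod.lessThan_Suc_shift) (simp add: mult.assoc)
  also have "(\<Prod>j<m. y + (x * q) * q ^ j) = (\<Sum>k\<le>m. t k)"
    unfolding Suc.IH by (simp add: t_def power_mult_distrib mult_ac)
  also have "(y + x) * (\<Sum>k\<le>m. t k) = y * (\<Sum>k\<le>m. t k) + x * (\<Sum>k\<le>m. t k)"
    by (simp add: algebra_simps)
  also have "y * (\<Sum>k\<le>m. t k) = y ^ Suc m + (\<Sum>k\<le>m. if k < m then y * t (Suc k) else 0)"
  proof -
    have "(\<Sum>k\<le>m. t k) = t 0 + (\<Sum>k<m. t (Suc k))"
      by (simp add: sum.atMost_shift)
    moreover have "(\<Sum>k\<le>m. if k < m then y * t (Suc k) else 0) = (\<Sum>k<m. y * t (Suc k))"
      by (intro sum.mono_neutral_cong_right) auto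
    ultimately show ?thesis
      by (simp add: algebra_simps sum_distrib_left t_def)
  qed
  also have "y ^ Suc m + (\<Sum>k\<le>m. if k < m then y * t (Suc k) else 0) + x * (\<Sum>k\<le>m. t k) =
      y ^ Suc m + (\<Sum>k\<le>m. (if k < m then y * t (Suc k) else 0) + x * t k)"
    by (simp add: sum.distrib sum_distrib_left)
  also have "(\<Sum>k\<le>m. (if k < m then y * t (Suc k) else 0) + x * t k) =
      (\<Sum>k\<le>m. qbinom q (Suc m) (Suc k) * q ^ (Suc k choose 2) * x ^ Suc k * y ^ (Suc m - Suc k))"
  proof (rule sum.cong[OF refl])
    fix k assume k: "k \<in> {..m}"
    show "(if k < m then y * t (Suc k) else 0) + x * t k =
        qbinom q (Suc m) (Suc k) * q ^ (Suc k choose 2) * x ^ Suc k * y ^ (Suc m - Suc k)"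
    proof (cases "k < m")
      case True
      then have "y * y ^ (m - Suc k) = y ^ (m - k)"
        by (metis Suc_diff_Suc power_Suc)
      then have "y * t (Suc k) =
          qbinom q m (Suc k) * q ^ (Suc k choose 2) * q ^ Suc k * x ^ Suc k * y ^ (m - k)"
        unfolding t_def by (metis (no_types, lifting) mult.left_commute)
      then show ?thesis
        using True by (simp add: t_def Suc_choose_2 power_add algebra_simps)
    next
      case False
      with k have "k = m" by simp
      then show ?thesis
        by (simp add: t_def Suc_choose_2 power_add qbinom_eq_0)
    qed
  qed
  also have "y ^ Suc m + \<dots> =
      (\<Sum>k\<le>Suc m. qbinom q (Suc m) k * q ^ (k choose 2) * x ^ k * y ^ (Suc m - k))"
    by (subst sum.atMost_Suc_shift) simp
  finally show ?case .
qed simp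

section \<open>Jacobi's identity for the cube of the Euler product\<close>

lemma prod_lessThan_add:
  fixes f :: "nat \<Rightarrow> 'a::comm_monoid_mult"
  shows "(\<Prod>j<n + l. f j) = (\<Prod>j<n. f j) * (\<Prod>j<l. f (n + j))"
  by (induction l) (simp_all add: mult.assoc)

lemma sum_lessThan_add:
  fixes f :: "nat \<Rightarrow> 'a::comm_monoid_add"
  shows "(\<Sum>j<n + l. f j) = (\<Sum>j<n. f j) + (\<Sum>j<l. f (n + j))"
  by (induction l) (simp_all add: add.assoc)

lemma prod_power_lessThan: "(\<Prod>j<n. (q::'a::comm_ring_1) ^ j) = q ^ (n choose 2)"
  by (induction n) (simp_all add: Suc_choose_2 power_add)

lemma qfact_nonzero:
  fixes q :: complex
  assumes "norm q < 1"
  shows "qfact q n \<noteq> 0"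
proof -
  have "q ^ Suc j \<noteq> 1" for j
    using assms power_Suc_less_one[of "norm q" j]
    by (metis less_irrefl norm_ge_zero norm_one norm_power one_neq_zero power_eq_0_iff
        zero_less_norm_iff power_less_one_iff zero_less_Suc)
  then show ?thesis
    by (auto simp: qfact_def simp del: power_Suc)
qed

lemma add_choose_2: "(m + n) choose 2 = (m choose 2) + (n choose 2) + m * n"
  by (induction n) (simp_all add: Suc_choose_2)

text \<open>
  Differentiate the q-binomial theorem for \<open>2n + 1\<close> factors at the zero \<open>w = 1\<close> of the middle
  factor. By the symmetry of the q-binomial coefficients, the coefficients of \<open>w^(n - i)\<close> and
  \<open>w^(n + 1 + i)\<close> are negatives of each other. So the weights from the derivative combine, up to sign, to
  \<open>(n + 1 + i) - (n - i) = 2i + 1\<close>.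
\<close>

lemma jacobi_cube_finite:
  fixes q :: complex
  assumes q: "q \<noteq> 0" "norm q < 1"
  shows "(\<Sum>i\<le>n. (-1) ^ i * of_nat (2 * i + 1) * q ^ (Suc i choose 2) *
            (qfact q (2 * n + 1) / (qfact q (n - i) * qfact q (n + 1 + i)))) = qfact q n ^ 2"
proof -
  define m where "m = 2 * n + 1"
  define c where "c k = qbinom q m k * q ^ (k choose 2) * (- 1) ^ k * (q ^ n) ^ (m - k)" for k
  define R where "R w = (\<Prod>j<n. q ^ n - w * q ^ j) * (\<Prod>j<n. q ^ n - w * q ^ (n + Suc j))" for w
  \<comment> \<open>The power of \<open>q\<close> common to both sides, to be cancelled at the end.\<close>
  define E where "E = n + (n choose 2) + n * n"
  have expansion: "(\<Sum>k\<le>m. c k * w ^ k) = (1 - w) * (q ^ n * R w)" for w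
  proof -
    have "(\<Sum>k\<le>m. c k * w ^ k) = (\<Prod>j<m. q ^ n + (- w) * q ^ j)"
      unfolding qbinomial_theorem c_def
      by (intro sum.cong refl) (simp add: power_minus[of w] mult_ac)
    also have "\<dots> = (\<Prod>j<n. q ^ n - w * q ^ j) * (\<Prod>j<Suc n. q ^ n - w * q ^ (n + j))"
      using prod_lessThan_add[of "\<lambda>j. q ^ n - w * q ^ j" n "Suc n"] by (simp add: m_def mult_2)
    also have "\<dots> = (1 - w) * (q ^ n * R w)"
      unfolding R_def prod.lessThan_Suc_shift by (simp add: algebra_simps)
    finally show ?thesis .
  qed
  have "((\<lambda>w. \<Sum>k\<le>m. c k * w ^ k) has_field_derivative (\<Sum>k\<le>m. c k * of_nat k)) (at 1)"
    by (auto intro!: derivative_eq_intros sum.cong)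
  moreover have "R holomorphic_on UNIV"
    unfolding R_def by (intro holomorphic_intros)
  then obtain D where D: "(R has_field_derivative D) (at 1)"
    by (auto simp: holomorphic_on_def field_differentiable_def)
  then have "((\<lambda>w. (1 - w) * (q ^ n * R w)) has_field_derivative - (q ^ n * R 1)) (at 1)"
    by (auto intro!: derivative_eq_intros)
  ultimately have derivative: "(\<Sum>k\<le>m. c k * of_nat k) = - (q ^ n * R 1)"
    unfolding expansion by (rule DERIV_unique)
  \<comment> \<open>Each of the two products in \<open>R 1\<close> is a monomial times \<open>qfact q n\<close>.\<close>
  have "(\<Prod>j<n. q ^ n - q ^ j) = (\<Prod>j<n. q ^ n - q ^ (n - Suc j))"
    by (rule prod.nat_diff_reindex[symmetric])
  also have "\<dots> = (\<Prod>j<n. - 1 * q ^ (n - Suc j) * (1 - q ^ Suc j))"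
  proof (intro prod.cong refl)
    fix j assume "j \<in> {..<n}"
    then have "q ^ n = q ^ (n - Suc j) * q ^ Suc j"
      by (simp flip: power_add del: power_Suc)
    then show "q ^ n - q ^ (n - Suc j) = - 1 * q ^ (n - Suc j) * (1 - q ^ Suc j)"
      by (simp add: algebra_simps)
  qed
  also have "\<dots> = (-1) ^ n * q ^ (n choose 2) * qfact q n"
    unfolding prod.distrib prod.nat_diff_reindex[of "\<lambda>j. q ^ j"] prod_power_lessThan
    by (simp add: qfact_def)
  moreover have "(\<Prod>j<n. q ^ n - q ^ (n + Suc j)) = (\<Prod>j<n. q ^ n * (1 - q ^ Suc j))"
    by (intro prod.cong refl) (simp add: power_add algebra_simps)
  then have "(\<Prod>j<n. q ^ n - q ^ (n + Suc j)) = q ^ (n * n) * qfact q n"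
    by (simp add: prod.distrib power_mult qfact_def)
  ultimately have R1: "q ^ n * R 1 = q ^ E * ((-1) ^ n * qfact q n ^ 2)"
    by (simp add: R_def E_def power_add power2_eq_square)
  have quotient: "qbinom q m k = qfact q m / (qfact q k * qfact q (m - k))" if "k \<le> m" for k
    using qfact_mult_qbinom[of q k "m - k"] qfact_nonzero[OF q(2)] that
    by (auto simp: field_simps)
  have "(\<Sum>k\<le>m. c k * of_nat k) = (\<Sum>k<Suc n + Suc n. c k * of_nat k)"
    by (intro sum.cong) (auto simp: m_def)
  also have "\<dots> = (\<Sum>i<Suc n. c (Suc n - Suc i) * of_nat (Suc n - Suc i)) +
                   (\<Sum>i<Suc n. c (Suc n + i) * of_nat (Suc n + i))"
    unfolding sum_lessThan_add sum.nat_diff_reindex[of "\<lambda>k. c k * of_nat k"] ..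
  also have "\<dots> = (\<Sum>i<Suc n. - (q ^ E * (-1) ^ n) * ((-1) ^ i * of_nat (2 * i + 1) * q ^ (Suc i choose 2) *
            (qfact q (2 * n + 1) / (qfact q (n - i) * qfact q (n + 1 + i)))))"
    unfolding sum.distrib[symmetric]
  proof (intro sum.cong refl)
    fix i assume "i \<in> {..<Suc n}"
    then obtain l where l: "n = i + l"
      by (metis le_iff_add lessThan_iff less_Suc_eq_le)
    define Q where "Q = qfact q m / (qfact q l * qfact q (n + 1 + i))"
    have ml: "m - l = n + 1 + i" "m - (n + 1 + i) = l"
      by (simp_all add: m_def l)
    have Q: "qbinom q m l = Q" "qbinom q m (n + 1 + i) = Q"
      using quotient[of l] quotient[of "n + 1 + i"] unfolding ml
      by (simp_all add: Q_def m_def l mult.commute)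
    have e1: "(l choose 2) + n * (n + 1 + i) = E + (Suc i choose 2)"
      by (simp add: E_def l add_choose_2 Suc_choose_2 square_eq_choose_2 algebra_simps)
    have e2: "(n + 1 + i choose 2) + n * l = E + (Suc i choose 2)"
      by (simp add: E_def l add_choose_2 Suc_choose_2 square_eq_choose_2 algebra_simps)
    have "(-1 :: complex) ^ n * (-1) ^ i = (-1) ^ l"
      by (simp add: l power_add flip: power_mult_distrib mult.assoc)
    then have sgn: "(-1 :: complex) ^ l = (-1) ^ n * (-1) ^ i"
       "(-1 :: complex) ^ (n + 1 + i) = - ((-1) ^ n * (-1) ^ i)"
      by (simp_all add: power_add)
    have c1: "c l = Q * q ^ (E + (Suc i choose 2)) * ((-1) ^ n * (-1) ^ i)"
      unfolding c_def ml Q sgn e1[symmetric] by (simp add: power_add power_mult)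
    have c2: "c (n + 1 + i) = - (Q * q ^ (E + (Suc i choose 2)) * ((-1) ^ n * (-1) ^ i))"
      unfolding c_def ml Q sgn e2[symmetric] by (simp add: power_add power_mult)
    have "c l * of_nat l + c (n + 1 + i) * of_nat (n + 1 + i) =
       - (Q * q ^ (E + (Suc i choose 2)) * ((-1) ^ n * (-1) ^ i)) * of_nat (2 * i + 1)"
      unfolding c1 c2 by (simp add: l algebra_simps)
    also have "\<dots> = - (q ^ E * (-1) ^ n) * ((-1) ^ i * of_nat (2 * i + 1) * q ^ (Suc i choose 2) * Q)"
      by (simp add: power_add)
    finally show "c (Suc n - Suc i) * of_nat (Suc n - Suc i) + c (Suc n + i) * of_nat (Suc n + i) =
       - (q ^ E * (-1) ^ n) * ((-1) ^ i * of_nat (2 * i + 1) * q ^ (Suc i choose 2) *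
            (qfact q (2 * n + 1) / (qfact q (n - i) * qfact q (n + 1 + i))))"
      by (simp add: l Q_def m_def)
  qed
  finally show ?thesis
    unfolding derivative R1 sum_distrib_left[symmetric] lessThan_Suc_atMost
    using q(1) by (simp add: sum_distrib_left[symmetric] del: power_Suc)
qed

text \<open>Triangular numbers dominate their index, so a derivative of the geometric series is a majorant.\<close>

lemma summable_jacobi_series:
  fixes r :: real
  assumes "0 \<le> r" "r < 1"
  shows "summable (\<lambda>k. real (2 * k + 1) * r ^ (Suc k choose 2))"
proof (rule summable_comparison_test'[where N = 0 and g = "\<lambda>k. 2 * (real (Suc k) * r ^ k)"])
  show "summable (\<lambda>k. 2 * (real (Suc k) * r ^ k))"
    using geometric_deriv_sums[of r] assms by (intro summable_mult) (auto simp: sums_iff)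
  fix k :: nat
  have "r ^ (Suc k choose 2) \<le> r ^ k"
    using assms by (intro power_decreasing) (auto simp: Suc_choose_2)
  then have "real (2 * k + 1) * r ^ (Suc k choose 2) \<le> real (2 * Suc k) * r ^ k"
    using assms by (intro mult_mono) auto
  then show "norm (real (2 * k + 1) * r ^ (Suc k choose 2)) \<le> 2 * (real (Suc k) * r ^ k)"
    using assms by (simp add: algebra_simps)
qed

lemma qfact_tendsto:
  fixes q :: complex
  assumes "norm q < 1"
  shows "qfact q \<longlonglongrightarrow> (\<Prod>k. 1 - q ^ Suc k)" "(\<Prod>k. 1 - q ^ Suc k) \<noteq> 0"
proof -
  have conv: "convergent_prod (\<lambda>k. 1 - q ^ Suc k)"
    using convergent_prod_euler[of 1 q] assms by simp
  then show "qfact q \<longlonglongrightarrow> (\<Prod>k. 1 - q ^ Suc k)"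
    unfolding qfact_def by (subst LIMSEQ_lessThan_iff_atMost) (rule convergent_prod_LIMSEQ)
  have "1 - q ^ Suc k \<noteq> 0" for k
    using qfact_nonzero[OF assms, of "Suc k"] by (auto simp: qfact_Suc)
  then show "(\<Prod>k. 1 - q ^ Suc k) \<noteq> 0"
    by (rule prodinf_nonzero[OF conv])
qed

text \<open>
  In the finite identity every quotient of the three values of \<open>qfact\<close> tends to \<open>1 / P\<close>, where \<open>P\<close> is
  the Euler product, and the right-hand side tends to \<open>P^2\<close>. As \<open>qfact q\<close> converges to a nonzero
  limit, both it and its inverse are bounded; hence the limit may be taken term by term.
\<close>

theorem jacobi_cube:
  fixes q :: complex
  assumes q: "norm q < 1"
  shows "((\<lambda>k. of_int ((-1) ^ k * (2 * int k + 1)) * q ^ (Suc k choose 2)) has_sum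
            (\<Prod>k. 1 - q ^ Suc k) ^ 3) UNIV"
proof -
  define P where "P = (\<Prod>k. 1 - q ^ Suc k)"
  define t where "t k = (-1) ^ k * of_nat (2 * k + 1) * q ^ (Suc k choose 2)" for k
  have t_eq: "of_int ((-1) ^ k * (2 * int k + 1)) * q ^ (Suc k choose 2) = t k" for k
    by (simp add: t_def)
  have norm_t: "norm (t k) = real (2 * k + 1) * norm q ^ (Suc k choose 2)" for k
    unfolding t_def norm_mult norm_power norm_of_nat by simp
  have summable_t: "summable (\<lambda>k. norm (t k))"
    unfolding norm_t by (rule summable_jacobi_series) (use q in auto)
  have "t sums P ^ 3"
  proof (cases "q = 0")
    case True
    have "t k = 0" if "k \<notin> {0}" for k
      using that True by (cases k) (auto simp: t_def Suc_choose_2)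
    \<comment> \<open>At \<open>q = 0\<close> both sides are 1; the finite identity cannot be used, as it was divided by a power of \<open>q\<close>.\<close>
    then have "t sums (\<Sum>k\<in>{0}. t k)"
      by (intro sums_finite) auto
    moreover have "t 0 = 1" "P = 1"
      by (simp_all add: t_def P_def True Suc_choose_2)
    ultimately show ?thesis by simp
  next
    case False
    have lim: "qfact q \<longlonglongrightarrow> P" and P: "P \<noteq> 0"
      using qfact_tendsto[OF q] by (simp_all add: P_def)
    define g where
      "g k n = qfact q (2 * n + 1) * (inverse (qfact q (n - k)) * inverse (qfact q (n + 1 + k)))" for k n
    define a where "a k n = (if k \<le> n then t k * g k n else 0)" for k n
    have "(\<lambda>n. inverse (qfact q n)) \<longlonglongrightarrow> inverse P"
      by (intro tendsto_inverse lim P)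
    then have "Bseq (\<lambda>n. inverse (qfact q n))"
      by (intro convergent_imp_Bseq) (auto simp: convergent_def)
    then obtain C where C: "\<And>n. norm (inverse (qfact q n)) \<le> C"
      by (auto simp: Bseq_def)
    have "Bseq (qfact q)"
      using lim by (intro convergent_imp_Bseq) (auto simp: convergent_def)
    then obtain B where B: "\<And>n. norm (qfact q n) \<le> B"
      by (auto simp: Bseq_def)
    have C0: "0 \<le> C" and B0: "0 \<le> B"
      using order_trans[OF norm_ge_zero C] order_trans[OF norm_ge_zero B] by auto
    have norm_g: "norm (g k n) \<le> B * (C * C)" for k n
      unfolding g_def norm_mult by (intro mult_mono B C mult_nonneg_nonneg norm_ge_zero B0 C0)
    have g_lim: "g k \<longlonglongrightarrow> P * (inverse P * inverse P)" for k
      unfolding g_def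
    proof (intro tendsto_mult tendsto_inverse P)
      show "(\<lambda>n. qfact q (2 * n + 1)) \<longlonglongrightarrow> P"
        by (rule filterlim_compose[OF lim])
           (auto intro!: filterlim_subseq strict_monoI)
      show "(\<lambda>n. qfact q (n - k)) \<longlonglongrightarrow> P"
        by (rule filterlim_compose[OF lim]) (rule filterlim_minus_const_nat_at_top)
      show "(\<lambda>n. qfact q (n + 1 + k)) \<longlonglongrightarrow> P"
        by (rule filterlim_compose[OF lim])
           (auto intro!: filterlim_subseq strict_monoI)
    qed
    have "(\<lambda>n. suminf (\<lambda>k. a k n)) \<longlonglongrightarrow> suminf (\<lambda>k. t k * (P * (inverse P * inverse P)))"
    proof (rule conjunct2[OF conjunct2[OF tannerys_theorem]])
      show "(\<lambda>n. a k n) \<longlonglongrightarrow> t k * (P * (inverse P * inverse P))" for k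
      proof (rule Lim_transform_eventually)
        show "(\<lambda>n. t k * g k n) \<longlonglongrightarrow> t k * (P * (inverse P * inverse P))"
          by (intro tendsto_mult tendsto_const g_lim)
        show "\<forall>\<^sub>F n in sequentially. t k * g k n = a k n"
          using eventually_ge_at_top[of k] by eventually_elim (simp add: a_def)
      qed
      show "\<forall>\<^sub>F (k, n) in at_top \<times>\<^sub>F sequentially. norm (a k n) \<le> norm (t k) * (B * (C * C))"
        using norm_g B0 C0
        by (intro always_eventually) (auto simp: a_def norm_mult intro!: mult_left_mono)
      show "summable (\<lambda>k. norm (t k) * (B * (C * C)))"
        by (intro summable_mult2 summable_t)
    qed auto
    moreover have "suminf (\<lambda>k. a k n) = qfact q n ^ 2" for n
    proof -
      have "suminf (\<lambda>k. a k n) = (\<Sum>k\<le>n. a k n)"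
        by (intro suminf_finite) (auto simp: a_def)
      also have "\<dots> = qfact q n ^ 2"
        unfolding jacobi_cube_finite[OF False q, of n, symmetric]
        by (intro sum.cong refl) (simp add: a_def t_def g_def divide_inverse inverse_mult_distrib)
      finally show ?thesis .
    qed
    moreover have "(\<lambda>n. qfact q n ^ 2) \<longlonglongrightarrow> P ^ 2"
      by (intro tendsto_power lim)
    ultimately have "suminf (\<lambda>k. t k * (P * (inverse P * inverse P))) = P ^ 2"
      by (auto intro: LIMSEQ_unique)
    moreover have "suminf (\<lambda>k. t k * (P * (inverse P * inverse P))) = suminf t * inverse P"
      using P summable_norm_cancel[OF summable_t] by (subst suminf_mult2[symmetric]) auto
    ultimately have "suminf t = P ^ 3"
      using P by (simp add: field_simps power2_eq_square power3_eq_cube)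
    then show ?thesis
      using summable_norm_cancel[OF summable_t] by (auto simp: sums_iff)
  qed
  then show ?thesis
    unfolding t_eq P_def[symmetric] by (rule norm_summable_imp_has_sum[OF summable_t])
qed

section \<open>The coefficients as sums over solutions of quadratic equations\<close>

lemma has_sum_product_complex:
  fixes f :: "'a \<Rightarrow> complex" and g :: "'b \<Rightarrow> complex"
  assumes "(f has_sum F) A" "(g has_sum G) B"
  shows "((\<lambda>(x, y). f x * g y) has_sum F * G) (A \<times> B)"
proof (rule has_sum_SigmaI[where g = "\<lambda>x. f x * G"])
  show "((\<lambda>y. case (x, y) of (x, y) \<Rightarrow> f x * g y) has_sum f x * G) B" for x
    using has_sum_cmult_right[OF assms(2)] by simp
  show "((\<lambda>x. f x * G) has_sum F * G) A"
    by (rule has_sum_cmult_left[OF assms(1)])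
  have "(\<lambda>x. norm (f x)) summable_on A" "(\<lambda>y. norm (g y)) summable_on B"
    using has_sum_imp_summable[OF assms(1)] has_sum_imp_summable[OF assms(2)]
    by (simp_all only: summable_on_iff_abs_summable_on_complex)
  then have "(\<lambda>p. norm (case p of (x, y) \<Rightarrow> f x * g y)) summable_on A \<times> B"
    unfolding Infinite_Sum.abs_summable_on_Sigma_iff
    by (auto simp: norm_mult infsum_cmult_right' abs_mult intro!: summable_on_cmult_right summable_on_cmult_left)
  then show "(\<lambda>(x, y). f x * g y) summable_on A \<times> B"
    by (rule abs_summable_summable)
qed

definition signed_odd :: "nat \<Rightarrow> int" where
  "signed_odd k = (-1) ^ k * (2 * int k + 1)"

lemma signed_odd_square: "signed_odd k ^ 2 = 8 * int (Suc k choose 2) + 1"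
proof -
  have "signed_odd k ^ 2 = (2 * int k + 1) ^ 2"
    by (simp add: signed_odd_def power_mult_distrib flip: power_mult)
  also have "\<dots> = 4 * int (k * k) + 4 * int k + 1"
    by (simp add: power2_eq_square algebra_simps)
  also have "\<dots> = 8 * int (Suc k choose 2) + 1"
    by (simp only: square_eq_choose_2 Suc_choose_2) simp
  finally show ?thesis .
qed

text \<open>Of the two integers with absolute value \<open>2k + 1\<close>, the sign \<open>(-1)^k\<close> selects the one that is 1 modulo 4.\<close>

lemma bij_signed_odd: "bij_betw signed_odd UNIV {x. x mod 4 = 1}"
proof (rule bij_betw_byWitness[where f' = "\<lambda>x. nat ((\<bar>x\<bar> - 1) div 2)"])
  show "\<forall>k\<in>UNIV. nat ((\<bar>signed_odd k\<bar> - 1) div 2) = k"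
    by (simp add: signed_odd_def abs_mult)
  show "\<forall>x\<in>{x. x mod 4 = 1}. signed_odd (nat ((\<bar>x\<bar> - 1) div 2)) = x"
  proof safe
    fix x :: int assume x: "x mod 4 = 1"
    define k where "k = x div 4"
    have k: "x = 4 * k + 1" using x unfolding k_def by presburger
    show "signed_odd (nat ((\<bar>x\<bar> - 1) div 2)) = x"
    proof (cases "k \<ge> 0")
      case True
      then have "nat ((\<bar>x\<bar> - 1) div 2) = 2 * nat k" by (simp add: k)
      then show ?thesis using True by (simp add: signed_odd_def k)
    next
      case False
      then have "nat ((\<bar>x\<bar> - 1) div 2) = 2 * nat (- k - 1) + 1" by (simp add: k)
      then show ?thesis using False by (simp add: signed_odd_def k)
    qed
  qed
  show "signed_odd ` UNIV \<subseteq> {x. x mod 4 = 1}"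
  proof safe
    fix k :: nat
    show "signed_odd k mod 4 = 1"
    proof (cases "even k")
      case True
      then obtain j where "k = 2 * j" by (elim evenE)
      then have "signed_odd k = 4 * int j + 1" by (simp add: signed_odd_def)
      then show ?thesis by presburger
    next
      case False
      then obtain j where "k = 2 * j + 1" by (elim oddE)
      then have "signed_odd k = 4 * (- int j - 1) + 1" by (simp add: signed_odd_def)
      then show ?thesis by presburger
    qed
  qed
qed simp

text \<open>
  Jacobi's identity at \<open>q^a\<close> and at \<open>q^b\<close> turns the product into an absolutely convergent double
  series, which may be summed along the finite sets of constant exponent. Uniqueness of power
  series coefficients identifies the result, and \<open>signed_odd\<close> translates pairs of
  summation indices into pairs \<open>(x, y)\<close>.
\<close>

theorem lambda_coeff_eq_sum:
  assumes "0 < a" "0 < b"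
  shows "lambda_coeff a b n =
           (\<Sum>(x, y) \<in> {(x, y). x mod 4 = 1 \<and> y mod 4 = 1 \<and>
               int a * x\<^sup>2 + int b * y\<^sup>2 + 8 = 8 * int n + int a + int b}. x * y)"
proof -
  define e where "e = (\<lambda>(i, j). 1 + a * (Suc i choose 2) + b * (Suc j choose 2))"
  define A where "A n = {p. e p = n}" for n
  define c where "c n = (\<Sum>(i, j)\<in>A n. signed_odd i * signed_odd j)" for n
  have index_le: "k \<le> d * (Suc k choose 2)" if "0 < d" for k d
  proof -
    have "k \<le> Suc k choose 2" by (simp add: Suc_choose_2)
    also have "\<dots> \<le> d * (Suc k choose 2)" using that by simp
    finally show ?thesis .
  qed
  have fin: "finite (A n)" for n
  proof (rule finite_subset)
    have "i \<le> n \<and> j \<le> n" if "e (i, j) = n" for i j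
    proof -
      have "i \<le> a * (Suc i choose 2)" "j \<le> b * (Suc j choose 2)"
        using assms by (auto intro!: index_le simp del: binomial_Suc_Suc)
      then show ?thesis
        using that by (simp add: e_def del: binomial_Suc_Suc)
    qed
    then show "A n \<subseteq> {..n} \<times> {..n}"
      by (auto simp: A_def)
  qed simp
  have "(\<lambda>n. of_int (c n) * q ^ n) sums eta_prod a b q" if q: "norm q < 1" for q :: complex
  proof -
    define h where "h = (\<lambda>p. of_int (case p of (i, j) \<Rightarrow> signed_odd i * signed_odd j) * q ^ e p)"
    have cube: "((\<lambda>k. of_int (signed_odd k) * q ^ (d * (Suc k choose 2))) has_sum
        (\<Prod>k. 1 - q ^ (d * Suc k)) ^ 3) UNIV" if "0 < d" for d
    proof -
      have "norm (q ^ d) < 1"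
        using q that by (simp add: norm_power power_less_one_iff)
      from jacobi_cube[OF this] show ?thesis
        by (simp only: power_mult signed_odd_def)
    qed
    have "(h has_sum eta_prod a b q) (UNIV \<times> UNIV)"
      unfolding eta_prod_eq[OF assms q]
      using has_sum_cmult_right[OF has_sum_product_complex[OF cube[OF assms(1)] cube[OF assms(2)]], of q]
      by (rule has_sum_cong[THEN iffD1, rotated])
         (auto simp: h_def e_def power_add)
    then have "((\<lambda>(n, p). h p) has_sum eta_prod a b q) (Sigma UNIV A)"
      by (subst has_sum_reindex_bij_witness[where T = UNIV and j = snd and i = "\<lambda>p. (e p, p)" and h = h])
         (auto simp: A_def)
    then have "((\<lambda>n. \<Sum>p\<in>A n. h p) has_sum eta_prod a b q) UNIV"
      by (rule has_sum_SigmaD) (use fin in auto)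
    moreover have "(\<Sum>p\<in>A n. h p) = of_int (c n) * q ^ n" for n
    proof -
      have "(\<Sum>p\<in>A n. h p) = (\<Sum>p\<in>A n. of_int (case p of (i, j) \<Rightarrow> signed_odd i * signed_odd j) * q ^ n)"
        by (intro sum.cong refl) (simp add: h_def A_def)
      then show ?thesis
        by (simp add: c_def sum_distrib_right)
    qed
    ultimately show ?thesis
      by (simp add: has_sum_imp_sums)
  qed
  then have "lambda_coeff a b = c"
    using power_series_coeff_unique[where F = "eta_prod a b"] sums_lambda_coeff[OF assms] by blast
  moreover have "c n = (\<Sum>(x, y) \<in> {(x, y). x mod 4 = 1 \<and> y mod 4 = 1 \<and>
               int a * x\<^sup>2 + int b * y\<^sup>2 + 8 = 8 * int n + int a + int b}. x * y)"
    (is "_ = sum _ ?X")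
  proof -
    have exponent: "int a * (signed_odd i)\<^sup>2 + int b * (signed_odd j)\<^sup>2 + 8 = 8 * int n + int a + int b
        \<longleftrightarrow> (i, j) \<in> A n" for i j
    proof -
      have "int a * (signed_odd i)\<^sup>2 + int b * (signed_odd j)\<^sup>2 + 8 = 8 * int (e (i, j)) + int a + int b"
        by (simp add: signed_odd_square e_def algebra_simps)
      then show ?thesis by (simp add: A_def)
    qed
    have inj: "inj signed_odd" and range: "range signed_odd = {x. x mod 4 = 1}"
      using bij_signed_odd by (auto simp: bij_betw_def)
    have "map_prod signed_odd signed_odd ` A n = ?X"
    proof (intro equalityI subsetI)
      fix z assume "z \<in> map_prod signed_odd signed_odd ` A n"
      then show "z \<in> ?X" using exponent range by auto
    next
      fix z assume z: "z \<in> ?X"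
      then have "fst z \<in> range signed_odd" "snd z \<in> range signed_odd"
        unfolding range by auto
      then obtain i j where "z = (signed_odd i, signed_odd j)"
        by (metis imageE prod.collapse)
      with z exponent show "z \<in> map_prod signed_odd signed_odd ` A n" by force
    qed
    then have "bij_betw (map_prod signed_odd signed_odd) (A n) ?X"
      using prod.inj_map[OF inj inj] by (auto simp: bij_betw_def intro: inj_on_subset)
    from sum.reindex_bij_betw[OF this, of "\<lambda>(x, y). x * y"] show ?thesis
      by (simp add: c_def case_prod_unfold)
  qed
  ultimately show ?thesis by simp
qed

section \<open>Reduction of the solution sets to one quadratic form\<close>

text \<open>
  With \<open>x = y + 4k\<close> the equation reads \<open>2y^2 + y k + 2k^2 = 2N\<close>, so \<open>k = 2j\<close> for some \<open>j\<close>; then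
  \<open>y^2 + y j + 4j^2 = N\<close>, and as \<open>N\<close> is odd, \<open>j\<close> is even too.
\<close>

lemma dvd_16_diff_of_form_1_15:
  fixes x y N :: int
  assumes y: "odd y" and eq: "x\<^sup>2 + 15 * y\<^sup>2 = 16 * N" and xy: "x mod 4 = y mod 4" and N: "odd N"
  shows "16 dvd x - y"
proof -
  from xy obtain k where k: "x = y + 4 * k"
    by (metis add.commute diff_add_cancel dvd_def mod_eq_dvd_iff)
  have "y * k = 2 * (N - y\<^sup>2 - k\<^sup>2)"
    using eq by (simp add: k power2_eq_square algebra_simps)
  then have "even (y * k)"
    by simp
  then obtain j where j: "k = 2 * j" using y by auto
  have "y\<^sup>2 + 4 * j\<^sup>2 + y * j = N"
    using eq by (simp add: k j power2_eq_square algebra_simps)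
  then have "even j" using y N
    by (metis even_add even_mult_iff even_numeral even_power mod2_eq_if pos2 zero_neq_one dvd_triv_left)
  then show ?thesis by (auto simp: k j)
qed

text \<open>
  Multiplying \<open>u - v\<surd>(-15)\<close> by \<open>\<surd>3 + \<surd>(-5)\<close> gives \<open>x\<surd>3 + y\<surd>(-5)\<close> with \<open>x = u + 5v\<close> and
  \<open>y = u - 3v\<close>. So \<open>3x^2 + 5y^2 = 8(u^2 + 15v^2)\<close>, and both \<open>x\<close> and \<open>y\<close> are congruent to \<open>u + v\<close> modulo 4. What needs an argument is that \<open>v = (x - y)/8\<close> is an
  integer: this is where \<open>N\<close> odd enters.
\<close>

lemma sum_over_form_3_5:
  fixes N :: int
  assumes "odd N"
  shows "(\<Sum>(x, y) \<in> {(x, y). x mod 4 = 1 \<and> y mod 4 = 1 \<and> 3 * x\<^sup>2 + 5 * y\<^sup>2 = 8 * N}. x * y) =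
    (\<Sum>(u, v) \<in> {(u, v). (u + v) mod 4 = 1 \<and> u\<^sup>2 + 15 * v\<^sup>2 = N}. u\<^sup>2 + 2 * (u * v) - 15 * v\<^sup>2)"
proof (rule sum.reindex_bij_witness[where
   i = "\<lambda>(u, v). (u + 5 * v, u - 3 * v)" and j = "\<lambda>(x, y). ((3 * x + 5 * y) div 8, (x - y) div 8)"],
   goal_cases)
  have ex: "\<exists>u v. x = u + 5 * v \<and> y = u - 3 * v \<and> (u + v) mod 4 = 1 \<and> u\<^sup>2 + 15 * v\<^sup>2 = N"
    if "x mod 4 = 1" "y mod 4 = 1" "3 * x\<^sup>2 + 5 * y\<^sup>2 = 8 * N" for x y :: int
  proof -
    from that obtain k where k: "x = y + 4 * k"
      by (metis add.commute diff_add_cancel dvd_def mod_eq_dvd_iff)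
    have "y\<^sup>2 + 6 * k\<^sup>2 + 3 * (y * k) = N"
      using that by (simp add: k power2_eq_square algebra_simps)
    moreover have "odd y" using that by presburger
    ultimately have "even k" using assms
      by (metis even_add even_mult_iff even_numeral even_power odd_numeral pos2)
    then obtain v where v: "k = 2 * v" by auto
    then have "x = (y + 3 * v) + 5 * v" "y = (y + 3 * v) - 3 * v"
      using k by simp_all
    moreover have "((y + 3 * v) + v) mod 4 = 1"
      using that(2) by presburger
    moreover have "(y + 3 * v)\<^sup>2 + 15 * v\<^sup>2 = N"
      using \<open>y\<^sup>2 + 6 * k\<^sup>2 + 3 * (y * k) = N\<close> by (simp add: v power2_eq_square algebra_simps)
    ultimately show ?thesis by blast
  qed
  {
    case (1 a) then show ?case using ex by fastforce
  next
    case (2 a) then show ?case using ex by fastforce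
  next
    case (3 b) then show ?case by auto
  next
    case (4 b) then show ?case
      by (auto simp: power2_eq_square algebra_simps; presburger)
  next
    case (5 a)
    then show ?case using ex by (fastforce simp: power2_eq_square algebra_simps)
  }
qed

text \<open>
  The substitution is multiplication of \<open>u + v\<surd>(-15)\<close> by \<open>1 + \<surd>(-15)\<close>, an element of norm 16;
  modulo 4, both \<open>x = u - 15v\<close> and \<open>y = u + v\<close> are \<open>u + v\<close>.
\<close>

lemma sum_over_form_1_15:
  fixes N :: int
  assumes "odd N"
  shows "(\<Sum>(x, y) \<in> {(x, y). x mod 4 = 1 \<and> y mod 4 = 1 \<and> x\<^sup>2 + 15 * y\<^sup>2 = 16 * N}. x * y) =
    (\<Sum>(u, v) \<in> {(u, v). (u + v) mod 4 = 1 \<and> u\<^sup>2 + 15 * v\<^sup>2 = N}. u\<^sup>2 + (-14) * (u * v) - 15 * v\<^sup>2)"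
proof (rule sum.reindex_bij_witness[where
   i = "\<lambda>(u, v). (u - 15 * v, u + v)" and j = "\<lambda>(x, y). ((x + 15 * y) div 16, (y - x) div 16)"],
   goal_cases)
  have ex: "\<exists>u v. x = u - 15 * v \<and> y = u + v \<and> (u + v) mod 4 = 1 \<and> u\<^sup>2 + 15 * v\<^sup>2 = N"
    if "x mod 4 = 1" "y mod 4 = 1" "x\<^sup>2 + 15 * y\<^sup>2 = 16 * N" for x y :: int
  proof -
    have "odd y" using that(2) by presburger
    then have "16 dvd x - y"
      using that dvd_16_diff_of_form_1_15 assms by metis
    then obtain w where "x - y = 16 * w" by (auto simp: dvd_def)
    then have v: "x = y - 16 * (- w)" by simp
    then have "x = (y + w) - 15 * (- w)" "y = (y + w) + - w"
      by simp_all
    moreover have "(y + w)\<^sup>2 + 15 * (- w)\<^sup>2 = N"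
      using that(3) by (simp add: v power2_eq_square algebra_simps)
    ultimately show ?thesis using that(2) by metis
  qed
  {
    case (1 a) then show ?case using ex by fastforce
  next
    case (2 a) then show ?case using ex by fastforce
  next
    case (3 b) then show ?case by auto
  next
    case (4 b) then show ?case
      by (auto simp: power2_eq_square algebra_simps; presburger)
  next
    case (5 a)
    then show ?case using ex by (fastforce simp: power2_eq_square algebra_simps)
  }
qed

text \<open>
  If \<open>N\<close> is odd then so is \<open>u + v\<close>, hence the congruence modulo 4 holds for exactly one of \<open>(u, v)\<close>
  and \<open>(-u, -v)\<close>, while the summand has the same value at both. The mixed term drops out because \<open>v \<mapsto> -v\<close> preserves
  the set of all solutions.
\<close>

lemma sum_half_system_eq:
  fixes N c :: int
  assumes "odd N"
  shows "2 * (\<Sum>(u, v) \<in> {(u, v). (u + v) mod 4 = 1 \<and> u\<^sup>2 + 15 * v\<^sup>2 = N}. u\<^sup>2 + c * (u * v) - 15 * v\<^sup>2) =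
     (\<Sum>(u, v) \<in> {(u, v). u\<^sup>2 + 15 * v\<^sup>2 = N}. u\<^sup>2 - 15 * v\<^sup>2)"
proof -
  define S where "S = {(u, v). u\<^sup>2 + 15 * v\<^sup>2 = N}"
  define H where "H = {(u, v). (u + v) mod 4 = 1 \<and> u\<^sup>2 + 15 * v\<^sup>2 = N}"
  define f where "f = (\<lambda>(u, v). u\<^sup>2 + c * (u * v) - 15 * v\<^sup>2)"
  have fin: "finite S" unfolding S_def by (rule finite_form_reps)
  have "H \<subseteq> S" by (auto simp: H_def S_def)
  have odd: "odd (u + v)" if "(u, v) \<in> S" for u v
  proof -
    have "odd (u\<^sup>2 + 15 * v\<^sup>2)" using that assms by (simp add: S_def)
    then show ?thesis by simp
  qed
  have "sum f (S - H) = sum f H"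
  proof (rule sum.reindex_bij_witness[where i = "\<lambda>(u, v). (- u, - v)" and j = "\<lambda>(u, v). (- u, - v)"], goal_cases)
    case (2 a)
    obtain u v where a: "a = (u, v)" by force
    have "odd (u + v)" "(u + v) mod 4 \<noteq> 1" "(u, v) \<in> S" using 2 odd by (auto simp: a H_def S_def)
    moreover from this have "(- v - u) mod 4 = 1" by presburger
    ultimately show ?case by (simp add: a H_def S_def)
  next
    case (4 a)
    obtain u v where a: "a = (u, v)" by force
    have "(u + v) mod 4 = 1" "(u, v) \<in> S" using 4 by (auto simp: a H_def S_def)
    moreover from this have "(- v - u) mod 4 \<noteq> 1" by presburger
    ultimately show ?case by (simp add: a H_def S_def)
  qed (auto simp: f_def)
  then have 1: "2 * sum f H = sum f S"
    using sum.subset_diff[OF \<open>H \<subseteq> S\<close> fin, of f] by simp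
  have "(\<Sum>(u, v)\<in>S. u * v) = (\<Sum>(u, v)\<in>S. - (u * v))"
    by (rule sum.reindex_bij_witness[where i = "\<lambda>(u, v). (u, - v)" and j = "\<lambda>(u, v). (u, - v)"])
       (auto simp: S_def)
  then have 2: "(\<Sum>(u, v)\<in>S. u * v) = 0"
    by (simp add: sum_negf case_prod_unfold)
  have "sum f S = (\<Sum>(u, v)\<in>S. u\<^sup>2 - 15 * v\<^sup>2) + c * (\<Sum>(u, v)\<in>S. u * v)"
    by (simp add: f_def sum_distrib_left case_prod_unfold flip: sum.distrib)
       (intro sum.cong refl, simp)
  then show ?thesis using 1 2 by (simp add: H_def S_def f_def)
qed

theorem theorem5p2:
  fixes n :: nat
  assumes "n > 0"
  shows "lambda_coeff 1 15 (4 * n + 1) = lambda_coeff 3 5 (2 * n + 1) \<and>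
         real_of_int (lambda_coeff 3 5 (2 * n + 1)) =
           1 / 2 * (\<Sum>(x, y) \<in> {(x::int, y::int). x\<^sup>2 + 15 * y\<^sup>2 = 2 * int n + 1}.
                      real_of_int (x\<^sup>2 - 15 * y\<^sup>2))"
proof -
  define N where "N = 2 * int n + 1"
  define S where "S = (\<Sum>(x, y) \<in> {(x, y). x\<^sup>2 + 15 * y\<^sup>2 = N}. x\<^sup>2 - 15 * y\<^sup>2)"
  have N: "odd N" by (simp add: N_def)
  have "lambda_coeff 3 5 (2 * n + 1) =
      (\<Sum>(x, y) \<in> {(x, y). x mod 4 = 1 \<and> y mod 4 = 1 \<and> 3 * x\<^sup>2 + 5 * y\<^sup>2 = 8 * N}. x * y)"
    by (subst lambda_coeff_eq_sum)
       (auto simp: N_def algebra_simps intro!: arg_cong[where f = "sum _"])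
  then have 1: "2 * lambda_coeff 3 5 (2 * n + 1) = S"
    unfolding sum_over_form_3_5[OF N] S_def using sum_half_system_eq[OF N, of 2] by simp
  have "lambda_coeff 1 15 (4 * n + 1) =
      (\<Sum>(x, y) \<in> {(x, y). x mod 4 = 1 \<and> y mod 4 = 1 \<and> x\<^sup>2 + 15 * y\<^sup>2 = 16 * N}. x * y)"
    by (subst lambda_coeff_eq_sum)
       (auto simp: N_def algebra_simps intro!: arg_cong[where f = "sum _"])
  then have 2: "2 * lambda_coeff 1 15 (4 * n + 1) = S"
    unfolding sum_over_form_1_15[OF N] S_def using sum_half_system_eq[OF N, of "-14"] by simp
  have "(\<Sum>(x, y) \<in> {(x, y). x\<^sup>2 + 15 * y\<^sup>2 = 2 * int n + 1}. real_of_int (x\<^sup>2 - 15 * y\<^sup>2)) =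
      real_of_int S"
    by (simp add: S_def N_def case_prod_unfold)
  moreover have "real_of_int S = 2 * real_of_int (lambda_coeff 3 5 (2 * n + 1))"
    unfolding 1[symmetric] by simp
  ultimately show ?thesis using 1 2 by simp
qed

end
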